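(* Let the quantities $t_f^*$, $\bm r(t)$, $\bm v(t)$, $m(t)$, $\lambda_m(t)$, $V(t)$, $\bm\lambda_v(t)$, $\bm\lambda_r$, $\hat{\bm\imath}_\theta^*(t)$, $T^*(t)$ be constructed from the network weights $\theta$ and the initial state $(\bm r_0,\bm v_0,m_0)$ as described in the context, with $t_0=0$. Then for every $\theta\in\mathbb R^{n_\theta}$ and every $(\bm r_0,\bm v_0,m_0)\in\Omega$, the following hold exactly: 1. (initial conditions) $\bm r(t_0)=\bm r_0$, $\bm v(t_0)=\bm v_0$, $m(t_0)=m_0$; 2. (terminal conditions) $\bm r(t_f^* )=\bm r_f$, $\bm v(t_f^* )=\bm v_f$; 3. (mass-costate transversality) $\lambda_m(t_f^* )=0$; 4. (value positivity) $V(t)\ge 0$ for all $t\in[t_0,t_f^*]$; 5. (costate relation) $\dot{\bm\lambda}_v(t)=-\bm\lambda_r$ for all $t\in[t_0,t_f^*]$; 6. (minimum flight time) $t_f^*>t_f^{\min}$; 7. (control constraints) at every $t\in[t_0,t_f^*]$ with $\bm\lambda_v(t)\ne\bm 0$ and $m(t)\neq 0$, one has $0\le T^*(t)\le T_{\max}$ and $\|\hat{\bm\imath}_\theta^*(t)\|_2^2=1$.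
   Context: **Problem data.** $I_{sp},g_0,T_{\max}>0$ are fixed constants; $\bm r_f,\bm v_f\in\mathbb R^3$ are fixed terminal position and velocity; $t_f^{\min}>0$ is a fixed constant; the initial time is $t_0=0$. The region of initial states is the box $$\Omega=\{(\bm r_0,\bm v_0,m_0)\in\mathbb R^3\times\mathbb R^3\times\mathbb R:\ \bm r_0\in[\bm r_0^{\mathrm{lo}},\bm r_0^{\mathrm{hi}}],\ \bm v_0\in[\bm v_0^{\mathrm{lo}},\bm v_0^{\mathrm{hi}}],\ m_0\in[m_0^{\mathrm{lo}},m_0^{\mathrm{hi}}]\},$$ with componentwise bounds, lower bounds strictly less than upper bounds, and $m_0^{\mathrm{lo}}>0$. Its center is $(\bm r_{0,\mathrm{center}},\bm v_{0,\mathrm{center}},m_{0,\mathrm{center}})$. The normalized initial state $(\bm r_{0,\mathrm{norm}},\bm v_{0,\mathrm{norm}},m_{0,\mathrm{norm}})\in\mathbb R^7$ is obtained by subtracting the center of $\Omega$ and dividing by the half-width in each coordinate. **Networks.** Two fully connected feedforward networks are used, each with two hidden layers with $\tanh$ activations and an affine output layer. The condition encoder $\mathrm{NN}_{\mathrm{cond}}:\mathbb R^7\to\mathbb R^7$ has hidden width 32. The main trunk $\mathbb R^8\to\mathbb R^9$ has hidden width 64. $\theta\in\mathbb R^{n_\theta}$, $n_\theta=6864$, collects all weights and biases of both. The condition encoder outputs $$(\bm a_0,\bm a_1,\tau)=\mathrm{NN}_{\mathrm{cond}}(\bm r_{0,\mathrm{norm}},\bm v_{0,\mathrm{norm}},m_{0,\mathrm{norm}}),\quad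 \bm a_0,\bm a_1\in\mathbb R^3,\ \tau\in\mathbb R.$$ The main trunk, evaluated at $(\tilde t,\bm r_{0,\mathrm{norm}},\bm v_{0,\mathrm{norm}},m_{0,\mathrm{norm}})$, outputs $\mathrm{NN}_r(t)\in\mathbb R^3$, $\mathrm{NN}_v(t)\in\mathbb R^3$, $\mathrm{NN}_m(t),\mathrm{NN}_\lambda(t),\mathrm{NN}_V(t)\in\mathbb R$. **Scale constants.** $s_{tf}=60$, $s_r=0.4\max|\bm r_{0,\mathrm{center}}-\bm r_f|$, $s_v=2.0\max|\bm v_{0,\mathrm{center}}-\bm v_f|$ (maximum absolute component), $s_m=0.5\frac{T_{\max}}{I_{sp}g_0}s_{tf}$, $s_v^\lambda=0.5\,m_{0,\mathrm{center}}T_{\max}$, $s_\lambda=0.5\,T_{\max}I_{sp}g_0$, $s_V=0.3\,T_{\max}^2 s_{tf}$. **Constructions.** Let $\mathrm{softplus}(y)=\ln(1+e^y)$. The predicted final time is $$t_f^*=t_f^{\min}+s_{tf}\ln(1+e^\tau),$$ and $\tilde t=(t-t_0)/(t_f^*-t_0)\in[0,1]$ for $t\in[t_0,t_f^*]$. Define $$\bm r(t)=\bm r_0+\tilde t(\bm r_f-\bm r_0)+\tilde t(1-\tilde t)\,\mathrm{NN}_r(t)\,s_r,$$ $$\bm v(t)=\bm v_0+\tilde t(\bm v_f-\bm v_0)+\tilde t(1-\tilde t)\,\mathrm{NN}_v(t)\,s_v,$$ $$m(t)=m_0+\tilde t\,\mathrm{NN}_m(t)\,s_m,\qquad \lambda_m(t)=(1-\tilde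 t)\,\mathrm{NN}_\lambda(t)\,s_\lambda,$$ $$V(t)=(1-\tilde t)\,\mathrm{softplus}(\mathrm{NN}_V(t))\,s_V,\qquad \bm\lambda_v(t)=s_v^\lambda(\bm a_0-\bm a_1\tilde t),\qquad \bm\lambda_r=\frac{s_v^\lambda\,\bm a_1}{t_f^*}.$$ The control is $$\hat{\bm\imath}_\theta^*(t)=-\frac{\bm\lambda_v(t)}{\|\bm\lambda_v(t)\|_2},\qquad T^*(t)=\mathrm{clip}\Big(\tfrac12\Big(\tfrac{\|\bm\lambda_v(t)\|_2}{m(t)}+\tfrac{\lambda_m(t)}{I_{sp}g_0}\Big),0,T_{\max}\Big),$$ where $\mathrm{clip}(y,0,T_{\max})=\min(\max(y,0),T_{\max})$. A dot denotes the derivative with respect to physical time $t$. *)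

theory Defs
  imports "HOL-Analysis.Analysis"
begin

record problem =
  Isp :: real
  g0 :: real
  Tmax :: real
  tf_min :: real
  r_f :: "real^3"
  v_f :: "real^3"
  r_lo :: "real^3"
  r_hi :: "real^3"
  v_lo :: "real^3"
  v_hi :: "real^3"
  m_lo :: real
  m_hi :: real

definition valid_problem :: "problem \<Rightarrow> bool" where
  "valid_problem P \<longleftrightarrow>
     Isp P > 0 \<and> g0 P > 0 \<and> Tmax P > 0 \<and> tf_min P > 0 \<and>
     (\<forall>i. r_lo P $ i < r_hi P $ i) \<and> (\<forall>i. v_lo P $ i < v_hi P $ i) \<and>
     m_lo P < m_hi P \<and> m_lo P > 0"

definition t0 :: real where
  "t0 = 0"

type_synonym state = "(real^3) \<times> (real^3) \<times> real"

definition Omega :: "problem \<Rightarrow> state set" where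
  "Omega P = cbox (r_lo P) (r_hi P) \<times> cbox (v_lo P) (v_hi P) \<times> {m_lo P .. m_hi P}"

definition r_center :: "problem \<Rightarrow> real^3" where
  "r_center P = (1/2) *\<^sub>R (r_lo P + r_hi P)"

definition v_center :: "problem \<Rightarrow> real^3" where
  "v_center P = (1/2) *\<^sub>R (v_lo P + v_hi P)"

definition m_center :: "problem \<Rightarrow> real" where
  "m_center P = (m_lo P + m_hi P) / 2"

definition r_norm :: "problem \<Rightarrow> real^3 \<Rightarrow> real^3" where
  "r_norm P r = (\<chi> i. (r $ i - r_center P $ i) / ((r_hi P $ i - r_lo P $ i) / 2))"

definition v_norm :: "problem \<Rightarrow> real^3 \<Rightarrow> real^3" where
  "v_norm P v = (\<chi> i. (v $ i - v_center P $ i) / ((v_hi P $ i - v_lo P $ i) / 2))"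

definition m_norm :: "problem \<Rightarrow> real \<Rightarrow> real" where
  "m_norm P m = (m - m_center P) / ((m_hi P - m_lo P) / 2)"

definition state_norm :: "problem \<Rightarrow> state \<Rightarrow> real^7" where
  "state_norm P x0 = (case x0 of (r0, v0, m0) \<Rightarrow>
     let r = r_norm P r0; v = v_norm P v0
     in vector [r$1, r$2, r$3, v$1, v$2, v$3, m_norm P m0])"


text \<open>
  The parameter vector stores, in this order, weights (row by row) and biases of layers
  1, 2, 3 of the condition encoder (7-32-32-7, 1543 parameters), then those of the main trunk
  (8-64-64-9, 5321 parameters). Positions are counted from 1. In a numeral type of size
  \<open>n\<close> the indices are the residues mod \<open>n\<close>, so \<open>idx\<close>
  returns the representative in \<open>{1..n}\<close>, matching the index convention
  of \<open>vector\<close>.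
\<close>

type_synonym params = "real^6864"

definition idx :: "'n::semiring_1 \<Rightarrow> nat" where
  "idx i = (LEAST k. 0 < k \<and> of_nat k = i)"

definition weight :: "params \<Rightarrow> nat \<Rightarrow> real^'n::{finite,semiring_1}^'m::{finite,semiring_1}" where
  "weight \<theta> off = (\<chi> i j. \<theta> $ of_nat (off + (idx i - 1) * CARD('n) + idx j))"

definition bias :: "params \<Rightarrow> nat \<Rightarrow> real^'m::{finite,semiring_1}" where
  "bias \<theta> off = (\<chi> i. \<theta> $ of_nat (off + idx i))"

definition vtanh :: "real^'n \<Rightarrow> real^'n" where
  "vtanh z = (\<chi> i. tanh (z $ i))"

definition mlp ::
  "real^'i^'h \<Rightarrow> real^'h \<Rightarrow> real^'h^'h \<Rightarrow> real^'h \<Rightarrow> real^'h^'o \<Rightarrow> real^'o \<Rightarrow> real^'i \<Rightarrow> real^'o" where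
  "mlp W1 b1 W2 b2 W3 b3 x =
     W3 *v vtanh (W2 *v vtanh (W1 *v x + b1) + b2) + b3"

definition nn_cond :: "params \<Rightarrow> real^7 \<Rightarrow> real^7" where
  "nn_cond \<theta> =
     mlp (weight \<theta> 0 :: real^7^32) (bias \<theta> 224)
         (weight \<theta> 256) (bias \<theta> 1280)
         (weight \<theta> 1312) (bias \<theta> 1536)"

definition nn_trunk :: "params \<Rightarrow> real^8 \<Rightarrow> real^9" where
  "nn_trunk \<theta> =
     mlp (weight \<theta> 1543 :: real^8^64) (bias \<theta> 2055)
         (weight \<theta> 2119) (bias \<theta> 6215)
         (weight \<theta> 6279) (bias \<theta> 6855)"

definition a0 :: "problem \<Rightarrow> params \<Rightarrow> state \<Rightarrow> real^3" where
  "a0 P \<theta> x0 = (let y = nn_cond \<theta> (state_norm P x0) in vector [y$1, y$2, y$3])"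

definition a1 :: "problem \<Rightarrow> params \<Rightarrow> state \<Rightarrow> real^3" where
  "a1 P \<theta> x0 = (let y = nn_cond \<theta> (state_norm P x0) in vector [y$4, y$5, y$6])"

definition tau :: "problem \<Rightarrow> params \<Rightarrow> state \<Rightarrow> real" where
  "tau P \<theta> x0 = nn_cond \<theta> (state_norm P x0) $ 7"


text \<open>
  The largest absolute component of a vector is the library's \<^const>\<open>infnorm\<close>.
\<close>

definition s_tf :: real where
  "s_tf = 60"

definition s_r :: "problem \<Rightarrow> real" where
  "s_r P = 0.4 * infnorm (r_center P - r_f P)"

definition s_v :: "problem \<Rightarrow> real" where
  "s_v P = 2.0 * infnorm (v_center P - v_f P)"

definition s_m :: "problem \<Rightarrow> real" where
  "s_m P = 0.5 * (Tmax P / (Isp P * g0 P)) * s_tf"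

definition s_lambda_v :: "problem \<Rightarrow> real" where
  "s_lambda_v P = 0.5 * m_center P * Tmax P"

definition s_lambda :: "problem \<Rightarrow> real" where
  "s_lambda P = 0.5 * Tmax P * Isp P * g0 P"

definition s_V :: "problem \<Rightarrow> real" where
  "s_V P = 0.3 * (Tmax P)\<^sup>2 * s_tf"

definition softplus :: "real \<Rightarrow> real" where
  "softplus y = ln (1 + exp y)"

definition clip :: "real \<Rightarrow> real \<Rightarrow> real \<Rightarrow> real" where
  "clip y a b = min (max y a) b"

definition tf :: "problem \<Rightarrow> params \<Rightarrow> state \<Rightarrow> real" where
  "tf P \<theta> x0 = tf_min P + s_tf * ln (1 + exp (tau P \<theta> x0))"

definition t_tilde :: "problem \<Rightarrow> params \<Rightarrow> state \<Rightarrow> real \<Rightarrow> real" where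
  "t_tilde P \<theta> x0 t = (t - t0) / (tf P \<theta> x0 - t0)"

definition trunk_out :: "problem \<Rightarrow> params \<Rightarrow> state \<Rightarrow> real \<Rightarrow> real^9" where
  "trunk_out P \<theta> x0 t =
     (let n = state_norm P x0
      in nn_trunk \<theta> (vector [t_tilde P \<theta> x0 t, n$1, n$2, n$3, n$4, n$5, n$6, n$7]))"

definition NN_r :: "problem \<Rightarrow> params \<Rightarrow> state \<Rightarrow> real \<Rightarrow> real^3" where
  "NN_r P \<theta> x0 t = (let y = trunk_out P \<theta> x0 t in vector [y$1, y$2, y$3])"

definition NN_v :: "problem \<Rightarrow> params \<Rightarrow> state \<Rightarrow> real \<Rightarrow> real^3" where
  "NN_v P \<theta> x0 t = (let y = trunk_out P \<theta> x0 t in vector [y$4, y$5, y$6])"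

definition NN_m :: "problem \<Rightarrow> params \<Rightarrow> state \<Rightarrow> real \<Rightarrow> real" where
  "NN_m P \<theta> x0 t = trunk_out P \<theta> x0 t $ 7"

definition NN_lambda :: "problem \<Rightarrow> params \<Rightarrow> state \<Rightarrow> real \<Rightarrow> real" where
  "NN_lambda P \<theta> x0 t = trunk_out P \<theta> x0 t $ 8"

definition NN_V :: "problem \<Rightarrow> params \<Rightarrow> state \<Rightarrow> real \<Rightarrow> real" where
  "NN_V P \<theta> x0 t = trunk_out P \<theta> x0 t $ 9"

definition position :: "problem \<Rightarrow> params \<Rightarrow> state \<Rightarrow> real \<Rightarrow> real^3" where
  "position P \<theta> x0 t = (case x0 of (r0, v0, m0) \<Rightarrow>
     let s = t_tilde P \<theta> x0 t
     in r0 + s *\<^sub>R (r_f P - r0) + (s * (1 - s) * s_r P) *\<^sub>R NN_r P \<theta> x0 t)"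

definition velocity :: "problem \<Rightarrow> params \<Rightarrow> state \<Rightarrow> real \<Rightarrow> real^3" where
  "velocity P \<theta> x0 t = (case x0 of (r0, v0, m0) \<Rightarrow>
     let s = t_tilde P \<theta> x0 t
     in v0 + s *\<^sub>R (v_f P - v0) + (s * (1 - s) * s_v P) *\<^sub>R NN_v P \<theta> x0 t)"

definition mass :: "problem \<Rightarrow> params \<Rightarrow> state \<Rightarrow> real \<Rightarrow> real" where
  "mass P \<theta> x0 t = (case x0 of (r0, v0, m0) \<Rightarrow>
     m0 + t_tilde P \<theta> x0 t * NN_m P \<theta> x0 t * s_m P)"

definition lambda_m :: "problem \<Rightarrow> params \<Rightarrow> state \<Rightarrow> real \<Rightarrow> real" where
  "lambda_m P \<theta> x0 t = (1 - t_tilde P \<theta> x0 t) * NN_lambda P \<theta> x0 t * s_lambda P"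

definition V :: "problem \<Rightarrow> params \<Rightarrow> state \<Rightarrow> real \<Rightarrow> real" where
  "V P \<theta> x0 t = (1 - t_tilde P \<theta> x0 t) * softplus (NN_V P \<theta> x0 t) * s_V P"

definition lambda_v :: "problem \<Rightarrow> params \<Rightarrow> state \<Rightarrow> real \<Rightarrow> real^3" where
  "lambda_v P \<theta> x0 t = s_lambda_v P *\<^sub>R (a0 P \<theta> x0 - t_tilde P \<theta> x0 t *\<^sub>R a1 P \<theta> x0)"

definition lambda_r :: "problem \<Rightarrow> params \<Rightarrow> state \<Rightarrow> real^3" where
  "lambda_r P \<theta> x0 = (s_lambda_v P / tf P \<theta> x0) *\<^sub>R a1 P \<theta> x0"

definition thrust_dir :: "problem \<Rightarrow> params \<Rightarrow> state \<Rightarrow> real \<Rightarrow> real^3" where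
  "thrust_dir P \<theta> x0 t = - (lambda_v P \<theta> x0 t /\<^sub>R norm (lambda_v P \<theta> x0 t))"

definition thrust :: "problem \<Rightarrow> params \<Rightarrow> state \<Rightarrow> real \<Rightarrow> real" where
  "thrust P \<theta> x0 t =
     clip (1/2 * (norm (lambda_v P \<theta> x0 t) / mass P \<theta> x0 t
                  + lambda_m P \<theta> x0 t / (Isp P * g0 P))) 0 (Tmax P)"

end

theory Submission
  imports Defs
begin

text \<open>
  Each claim is built into the formula that wraps the network outputs. The one quantitative input
  is that the softplus function is strictly positive. It makes the predicted final time exceed the
  positive minimum flight time, so the normalized time is an increasing affine map taking the
  initial time to 0 and the final time to 1 (\<open>tf_gt_tf_min\<close>,
  \<open>t_tilde_initial\<close>, \<open>t_tilde_final\<close>). In the position and velocity,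
  the network terms carry a factor vanishing at both 0 and 1, so at the ends only the linear
  interpolation between the prescribed values survives; in the mass the corresponding factor
  vanishes at 0, in the mass costate at 1. The value function is a product of nonnegative factors
  as long as the normalized time is at most 1 (\<open>V_nonneg\<close>).

  The velocity costate is affine in the normalized time, whose constant rate is the reciprocal of
  the final time; this is exactly the factor in the definition of the position costate
  (\<open>lambda_v_has_vector_derivative\<close>). The control constraints come from clipping the
  thrust and normalizing its direction.
\<close>

lemma softplus_pos: "0 < softplus y"
  unfolding softplus_def by (simp add: add_pos_pos)

lemma tf_gt_tf_min: "tf_min P < tf P \<theta> x0"
  using softplus_pos[of "tau P \<theta> x0"] by (simp add: tf_def softplus_def s_tf_def)

lemma tf_pos:
  assumes "valid_problem P"
  shows "0 < tf P \<theta> x0"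
  using assms tf_gt_tf_min[of P \<theta> x0] by (simp add: valid_problem_def)

lemma t_tilde_initial: "t_tilde P \<theta> x0 t0 = 0"
  by (simp add: t_tilde_def)

lemma t_tilde_final:
  assumes "valid_problem P"
  shows "t_tilde P \<theta> x0 (tf P \<theta> x0) = 1"
  using tf_pos[OF assms, of \<theta> x0] by (simp add: t_tilde_def t0_def)

lemma t_tilde_le_1:
  assumes "valid_problem P" and "t \<le> tf P \<theta> x0"
  shows "t_tilde P \<theta> x0 t \<le> 1"
  using tf_pos[OF assms(1), of \<theta> x0] assms(2) by (simp add: t_tilde_def t0_def)

lemma V_nonneg:
  assumes "valid_problem P" and "t \<le> tf P \<theta> x0"
  shows "0 \<le> V P \<theta> x0 t"
  using t_tilde_le_1[OF assms] softplus_pos[of "NN_V P \<theta> x0 t"]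
  by (simp add: V_def s_V_def s_tf_def)

text \<open>
  Substituting the normalized time makes the velocity costate affine in physical time, with slope
  the negative of the position costate: the factor \<open>1 / tf\<close> in the position costate
  is the rate of the normalized time.
\<close>

lemma lambda_v_has_vector_derivative:
  "(lambda_v P \<theta> x0 has_vector_derivative - lambda_r P \<theta> x0) (at t)"
proof -
  have "lambda_v P \<theta> x0 = (\<lambda>t. s_lambda_v P *\<^sub>R a0 P \<theta> x0 - t *\<^sub>R lambda_r P \<theta> x0)"
    by (simp add: fun_eq_iff lambda_v_def lambda_r_def t_tilde_def t0_def scaleR_diff_right)
  moreover have "((\<lambda>t. s_lambda_v P *\<^sub>R a0 P \<theta> x0 - t *\<^sub>R lambda_r P \<theta> x0)
      has_vector_derivative - lambda_r P \<theta> x0) (at t)"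
    by (auto intro!: derivative_eq_intros)
  ultimately show ?thesis by simp
qed

lemma clip_bounds:
  assumes "a \<le> b"
  shows "a \<le> clip y a b" and "clip y a b \<le> b"
  using assms by (auto simp: clip_def)

lemma norm_thrust_dir:
  assumes "lambda_v P \<theta> x0 t \<noteq> 0"
  shows "norm (thrust_dir P \<theta> x0 t) = 1"
  using assms by (simp add: thrust_dir_def)

theorem lemma5p2:
  fixes P :: problem and \<theta> :: "real^6864"
    and r0 v0 :: "real^3" and m0 :: real
  assumes "valid_problem P"
    and "(r0, v0, m0) \<in> Omega P"
  shows "let x0 = (r0, v0, m0) in
    (position P \<theta> x0 t0 = r0 \<and> velocity P \<theta> x0 t0 = v0 \<and> mass P \<theta> x0 t0 = m0) \<and>
    (position P \<theta> x0 (tf P \<theta> x0) = r_f P \<and> velocity P \<theta> x0 (tf P \<theta> x0) = v_f P) \<and>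
    lambda_m P \<theta> x0 (tf P \<theta> x0) = 0 \<and>
    (\<forall>t \<in> {t0 .. tf P \<theta> x0}. V P \<theta> x0 t \<ge> 0) \<and>
    (\<forall>t \<in> {t0 .. tf P \<theta> x0}.
       (lambda_v P \<theta> x0 has_vector_derivative - lambda_r P \<theta> x0) (at t)) \<and>
    tf P \<theta> x0 > tf_min P \<and>
    (\<forall>t \<in> {t0 .. tf P \<theta> x0}. lambda_v P \<theta> x0 t \<noteq> 0 \<and> mass P \<theta> x0 t \<noteq> 0 \<longrightarrow>
       0 \<le> thrust P \<theta> x0 t \<and> thrust P \<theta> x0 t \<le> Tmax P \<and>
       (norm (thrust_dir P \<theta> x0 t))\<^sup>2 = 1)"
proof -
  define x0 where "x0 = (r0, v0, m0)"
  have "position P \<theta> x0 t0 = r0" "velocity P \<theta> x0 t0 = v0" "mass P \<theta> x0 t0 = m0"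
    by (simp_all add: x0_def position_def velocity_def mass_def t_tilde_initial)
  moreover have "position P \<theta> x0 (tf P \<theta> x0) = r_f P" "velocity P \<theta> x0 (tf P \<theta> x0) = v_f P"
    "lambda_m P \<theta> x0 (tf P \<theta> x0) = 0"
    by (simp_all add: x0_def position_def velocity_def lambda_m_def t_tilde_final[OF assms(1)])
  moreover have "0 \<le> thrust P \<theta> x0 t" "thrust P \<theta> x0 t \<le> Tmax P" for t
    using assms(1) unfolding thrust_def valid_problem_def by (simp_all add: clip_bounds)
  ultimately show ?thesis
    unfolding Let_def x0_def[symmetric]
    using V_nonneg[OF assms(1)] lambda_v_has_vector_derivative tf_gt_tf_min norm_thrust_dir
    by simp
qed

end
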